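(* Let $(\mathcal{V},\mathcal{E})$ be an acyclic directed hypergraph. For each vertex $v\in\mathcal{V}$ let $M_v$ be a topological vector space, and for each hyperedge $E\in\mathcal{E}$ let $p_E\colon\bigoplus_{v\in s(E)}M_v\to\bigoplus_{v\in t(E)}M_v$ be a continuous (not necessarily linear) map. Let $M=\bigoplus_{v\in\mathcal{V}}M_v$, and for each $E$ let $\bar p_E\colon M\to M$ be the composite $$M\to\bigoplus_{v\in s(E)}M_v\xrightarrow{\;p_E\;}\bigoplus_{v\in t(E)}M_v\to M$$ of the canonical projection, $p_E$, and the canonical inclusion. Then $\sum_{E\in\mathcal{E}}\bar p_E\colon M\to M$ is a machine.
   Context: $\bigoplus$ denotes the (finite) product of topological vector spaces, and maps into a topological vector space are added pointwise. A continuous map $f\colon M\to M$ on a topological vector space $M$ is a machine if, for every topological space $X$ and every continuous map $g\colon X\to M$, there exists a unique continuous map $h\colon X\to M$ such that $h=g+f\circ h$. A directed hypergraph is a pair of finite sets $(\mathcal{V},\mathcal{E})$ of vertices and hyperedges with $\mathcal{E}\subseteq\mathcal{P}(\mathcal{V})\times\mathcal{P}(\mathcal{V})$, where $\mathcal{P}$ denotes the power set; for $E\in\mathcal{E}$, $s(E)$ and $t(E)$ denote its first and second components (sets of source and target vertices, either possibly empty, not required to be disjoint). A path of length $q$ is a sequence $v_1=a,E_1,v_2,E_2,\dots,E_q,v_{q+1}=b$ with $a\in s(E_1)$, $v_j\in t(E_{j-1})\cap s(E_j)$ for $j\in\{2,\dots,q\}$, and $b\in t(E_q)$. It is a cycle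 if $b\in s(E_1)$ (so a hyperedge with overlapping source and target gives a cycle of length 1). A hypergraph is acyclic if it has no cycles. *)

theory Defs
  imports "HOL-Analysis.Analysis" "HOL-Algebra.Module"
begin

locale topological_field = Ring.field K for K (structure) +
  fixes TK :: "'k topology"
  assumes topspace_eq: "topspace TK = carrier K"
    and continuous_add: "continuous_map (prod_topology TK TK) TK (\<lambda>(a, b). a \<oplus> b)"
    and continuous_minus: "continuous_map TK TK (\<lambda>a. \<ominus> a)"
    and continuous_mult: "continuous_map (prod_topology TK TK) TK (\<lambda>(a, b). a \<otimes> b)"
    and continuous_inv:
      "continuous_map (subtopology TK (carrier K - {\<zero>})) TK (\<lambda>a. inv\<^bsub>K\<^esub> a)"

(* No separation axiom is imposed. *)
locale topological_vector_space = K: topological_field K TK + Module.module K M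
  for K :: "('k, 'c) ring_scheme" (structure) and TK
    and M :: "('k, 'm, 'd) module_scheme" (structure) +
  fixes T :: "'m topology"
  assumes topspace_eq: "topspace T = carrier M"
    and continuous_add: "continuous_map (prod_topology T T) T (\<lambda>(x, y). x \<oplus>\<^bsub>M\<^esub> y)"
    and continuous_smult: "continuous_map (prod_topology TK T) T (\<lambda>(a, x). a \<odot>\<^bsub>M\<^esub> x)"

(* The record type module extends ring, so it has fields mult and one;
   the locale module does not constrain them and they play no role here.
   The topology of the product is product_topology T I. *)
definition prod_module :: "'v set \<Rightarrow> ('v \<Rightarrow> ('k, 'm) module) \<Rightarrow> ('k, 'v \<Rightarrow> 'm) module" where
  "prod_module I M =
    \<lparr>carrier = (\<Pi>\<^sub>E i\<in>I. carrier (M i)),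
     mult = (\<lambda>x y. \<lambda>i\<in>I. x i \<otimes>\<^bsub>M i\<^esub> y i),
     one = (\<lambda>i\<in>I. \<one>\<^bsub>M i\<^esub>),
     zero = (\<lambda>i\<in>I. \<zero>\<^bsub>M i\<^esub>),
     add = (\<lambda>x y. \<lambda>i\<in>I. x i \<oplus>\<^bsub>M i\<^esub> y i),
     smult = (\<lambda>a x. \<lambda>i\<in>I. a \<odot>\<^bsub>M i\<^esub> x i)\<rparr>"

(* HOL cannot quantify over types inside a formula, so the carrier type 'x of the
   test spaces X is a parameter; a theorem with 'x free speaks about all of them.
   Functions are total in HOL, so uniqueness of h on topspace X is expressed
   by restricting to functions that are extensional on topspace X. *)
definition machine ::
  "'x itself \<Rightarrow> ('k, 'c) ring_scheme \<Rightarrow> 'k topology \<Rightarrow> ('k, 'm, 'd) module_scheme \<Rightarrow>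
    'm topology \<Rightarrow> ('m \<Rightarrow> 'm) \<Rightarrow> bool" where
  "machine (_ :: 'x itself) K TK M T f \<longleftrightarrow>
    topological_vector_space K TK M T \<and>
    continuous_map T T f \<and>
    (\<forall>(X :: 'x topology) g. continuous_map X T g \<longrightarrow>
      (\<exists>!h. h \<in> extensional (topspace X) \<and> continuous_map X T h \<and>
        (\<forall>x\<in>topspace X. h x = g x \<oplus>\<^bsub>M\<^esub> f (h x))))"

type_synonym 'v hyperedge = "'v set \<times> 'v set"

abbreviation src :: "'v hyperedge \<Rightarrow> 'v set" where "src E \<equiv> fst E"

abbreviation tgt :: "'v hyperedge \<Rightarrow> 'v set" where "tgt E \<equiv> snd E"

definition directed_hypergraph :: "'v set \<Rightarrow> 'v hyperedge set \<Rightarrow> bool" where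
  "directed_hypergraph V \<E> \<longleftrightarrow> finite V \<and> finite \<E> \<and> \<E> \<subseteq> Pow V \<times> Pow V"

(* vs = [v_1, ..., v_(q+1)] and es = [E_1, ..., E_q]; lists are indexed from 0. *)
definition hyperpath :: "'v hyperedge set \<Rightarrow> 'v list \<Rightarrow> 'v hyperedge list \<Rightarrow> bool" where
  "hyperpath \<E> vs es \<longleftrightarrow>
    es \<noteq> [] \<and> length vs = length es + 1 \<and> set es \<subseteq> \<E> \<and>
    hd vs \<in> src (hd es) \<and>
    (\<forall>j\<in>{1..<length es}. vs ! j \<in> tgt (es ! (j - 1)) \<inter> src (es ! j)) \<and>
    last vs \<in> tgt (last es)"

definition hypercycle :: "'v hyperedge set \<Rightarrow> 'v list \<Rightarrow> 'v hyperedge list \<Rightarrow> bool" where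
  "hypercycle \<E> vs es \<longleftrightarrow> hyperpath \<E> vs es \<and> last vs \<in> src (hd es)"

definition acyclic_hypergraph :: "'v hyperedge set \<Rightarrow> bool" where
  "acyclic_hypergraph \<E> \<longleftrightarrow> \<not> (\<exists>vs es. hypercycle \<E> vs es)"

definition prod_proj :: "'v set \<Rightarrow> ('v \<Rightarrow> 'm) \<Rightarrow> ('v \<Rightarrow> 'm)" where
  "prod_proj J x = restrict x J"

definition prod_incl ::
  "('v \<Rightarrow> ('k, 'm) module) \<Rightarrow> 'v set \<Rightarrow> 'v set \<Rightarrow> ('v \<Rightarrow> 'm) \<Rightarrow> ('v \<Rightarrow> 'm)" where
  "prod_incl M J I y = (\<lambda>i\<in>I. if i \<in> J then y i else \<zero>\<^bsub>M i\<^esub>)"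

definition extended_map ::
  "'v set \<Rightarrow> ('v \<Rightarrow> ('k, 'm) module) \<Rightarrow> ('v hyperedge \<Rightarrow> ('v \<Rightarrow> 'm) \<Rightarrow> ('v \<Rightarrow> 'm)) \<Rightarrow>
    'v hyperedge \<Rightarrow> ('v \<Rightarrow> 'm) \<Rightarrow> ('v \<Rightarrow> 'm)" where
  "extended_map V M p E = prod_incl M (tgt E) V \<circ> p E \<circ> prod_proj (src E)"

end

theory Submission
  imports Defs
begin

text \<open>Acyclicity makes the relation ``some hyperedge has \<open>u\<close> as a source and \<open>v\<close> as a target''
  on vertices well founded, and the \<open>v\<close>-component of \<open>f = \<Sum>\<^sub>E p\<^sub>E\<close> depends only on the components
  of its argument at predecessors of \<open>v\<close>. Hence for each \<open>y\<close> the iterates of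
  \<open>z \<mapsto> y + f z\<close> forget their starting point, component by component: for some \<open>N\<close> that does not
  depend on \<open>y\<close>, the \<open>N\<close>-th iterate is constant. This constant is the unique fixed point, and
  it depends continuously on \<open>y\<close> because it is a fixed finite composition of continuous maps.\<close>

section \<open>Products of topological vector spaces\<close>

lemma prod_module_simps:
  "carrier (prod_module I M) = (\<Pi>\<^sub>E i\<in>I. carrier (M i))"
  "\<zero>\<^bsub>prod_module I M\<^esub> = (\<lambda>i\<in>I. \<zero>\<^bsub>M i\<^esub>)"
  "x \<oplus>\<^bsub>prod_module I M\<^esub> y = (\<lambda>i\<in>I. x i \<oplus>\<^bsub>M i\<^esub> y i)"
  "a \<odot>\<^bsub>prod_module I M\<^esub> x = (\<lambda>i\<in>I. a \<odot>\<^bsub>M i\<^esub> x i)"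
  by (simp_all add: prod_module_def)

lemma module_prod_module:
  assumes "cring K" and mods: "\<And>i. i \<in> I \<Longrightarrow> Module.module K (M i)"
  shows "Module.module K (prod_module I M)"
proof (rule moduleI)
  have ab: "abelian_group (M i)" if "i \<in> I" for i
    using mods[OF that] by (simp add: Module.module_def)
  then have mon: "abelian_monoid (M i)" if "i \<in> I" for i
    using that by (simp add: abelian_group_def)
  show "abelian_group (prod_module I M)"
  proof (rule abelian_groupI)
    fix x assume x: "x \<in> carrier (prod_module I M)"
    show "\<exists>y\<in>carrier (prod_module I M). y \<oplus>\<^bsub>prod_module I M\<^esub> x = \<zero>\<^bsub>prod_module I M\<^esub>"
      using x ab
      by (intro bexI[where x = "\<lambda>i\<in>I. \<ominus>\<^bsub>M i\<^esub> x i"])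
        (auto simp: prod_module_simps PiE_iff abelian_group.l_neg abelian_group.a_inv_closed
          intro!: restrict_ext)
  qed (auto simp: prod_module_simps PiE_iff abelian_monoid.a_closed[OF mon]
      abelian_monoid.zero_closed[OF mon] abelian_monoid.a_assoc[OF mon]
      abelian_monoid.r_zero[OF mon] abelian_monoid.a_comm[OF mon] abelian_monoid.a_lcomm[OF mon]
      intro!: restrict_ext extensionalityI[of _ I])
qed (use assms in \<open>auto simp: prod_module_simps PiE_iff Module.module.smult_closed[OF mods]
    Module.module.smult_l_distr Module.module.smult_r_distr[OF mods] Module.module.smult_assoc1
    Module.module.smult_one intro!: restrict_ext extensionalityI[of _ I]\<close>)

lemma (in topological_vector_space) continuous_map_add:
  assumes "continuous_map X T f" "continuous_map X T g"
  shows "continuous_map X T (\<lambda>x. f x \<oplus>\<^bsub>M\<^esub> g x)"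
  using continuous_map_compose[OF continuous_map_pairedI[OF assms] continuous_add]
  by (simp add: o_def)

lemma (in topological_vector_space) continuous_map_smult:
  assumes "continuous_map X TK f" "continuous_map X T g"
  shows "continuous_map X T (\<lambda>x. f x \<odot>\<^bsub>M\<^esub> g x)"
  using continuous_map_compose[OF continuous_map_pairedI[OF assms] continuous_smult]
  by (simp add: o_def)

lemma (in topological_vector_space) continuous_map_finsum:
  assumes "finite A" "\<And>a. a \<in> A \<Longrightarrow> continuous_map X T (F a)"
  shows "continuous_map X T (\<lambda>x. \<Oplus>\<^bsub>M\<^esub>a\<in>A. F a x)"
  using assms
proof (induction A rule: finite_induct)
  case empty
  then show ?case by (simp add: topspace_eq)
next
  case (insert b A)
  have "continuous_map X T (\<lambda>x. F b x \<oplus>\<^bsub>M\<^esub> (\<Oplus>\<^bsub>M\<^esub>a\<in>A. F a x))"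
    using insert by (intro continuous_map_add) auto
  \<comment> \<open>Splitting off a summand needs all summands in \<open>carrier M\<close>, which is
    known only at points of \<open>topspace X\<close>; hence the agreement on
    \<open>topspace X\<close> alone, which \<open>continuous_map_eq\<close> accepts.\<close>
  moreover have "F b x \<oplus>\<^bsub>M\<^esub> (\<Oplus>\<^bsub>M\<^esub>a\<in>A. F a x) = (\<Oplus>\<^bsub>M\<^esub>a\<in>insert b A. F a x)"
    if "x \<in> topspace X" for x
  proof (rule M.finsum_insert[symmetric])
    show "(\<lambda>a. F a x) \<in> A \<rightarrow> carrier M" "F b x \<in> carrier M"
      using insert.prems that by (fastforce simp: continuous_map_def topspace_eq)+
  qed (use insert in auto)
  ultimately show ?case
    by (rule continuous_map_eq)
qed

text \<open>A map into a product is continuous as soon as its components are, and each component of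
  addition or scaling is the operation of one factor applied to projections.\<close>

lemma topological_vector_space_prod_module:
  assumes K: "topological_field K TK"
    and tvs: "\<And>i. i \<in> I \<Longrightarrow> topological_vector_space K TK (M i) (T i)"
  shows "topological_vector_space K TK (prod_module I M) (product_topology T I)"
proof -
  interpret K: topological_field K TK by (fact K)
  \<comment> \<open>\<open>TX\<close> stays arbitrary, so that this fact serves both addition, where
    it is the product itself, and scaling, where it is \<open>TK\<close>.\<close>
  have proj: "continuous_map (prod_topology TX (product_topology T I)) (T i) (\<lambda>z. snd z i)"
    if "i \<in> I" for i and TX :: "'z topology"
    using continuous_map_compose[OF continuous_map_snd continuous_map_product_projection[OF that]]
    by (simp add: o_def)
  have proj1: "continuous_map (prod_topology (product_topology T I) TX) (T i) (\<lambda>z. fst z i)"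
    if "i \<in> I" for i and TX :: "'z topology"
    using continuous_map_compose[OF continuous_map_fst continuous_map_product_projection[OF that]]
    by (simp add: o_def)
  have "Module.module K (prod_module I M)"
    using tvs by (intro module_prod_module K.is_cring) (simp add: topological_vector_space_def)
  moreover have "topspace (product_topology T I) = carrier (prod_module I M)"
    using topological_vector_space.topspace_eq[OF tvs] by (simp add: prod_module_simps cong: PiE_cong)
  moreover have "continuous_map (prod_topology (product_topology T I) (product_topology T I))
      (product_topology T I) (\<lambda>(x, y). x \<oplus>\<^bsub>prod_module I M\<^esub> y)"
    by (auto simp: prod_module_simps continuous_map_componentwise case_prod_beta
        intro!: topological_vector_space.continuous_map_add[OF tvs] proj proj1)
  moreover have "continuous_map (prod_topology TK (product_topology T I))
      (product_topology T I) (\<lambda>(a, x). a \<odot>\<^bsub>prod_module I M\<^esub> x)"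
    by (auto simp: prod_module_simps continuous_map_componentwise case_prod_beta
        intro!: topological_vector_space.continuous_map_smult[OF tvs] proj continuous_map_fst)
  ultimately show ?thesis
    by (intro topological_vector_space.intro topological_vector_space_axioms.intro K)
qed

section \<open>Fixed points through iterates that become constant\<close>

text \<open>Since one \<open>N\<close> serves every \<open>y\<close>, the solution over
  \<open>X\<close> is a finite formula in \<open>g\<close>, and its continuity needs no limit
  argument.\<close>

lemma (in topological_vector_space) machineI_iterate:
  assumes f: "continuous_map T T f"
    and const: "\<And>y z z'. \<lbrakk>y \<in> carrier M; z \<in> carrier M; z' \<in> carrier M\<rbrakk> \<Longrightarrow>
      ((\<lambda>w. y \<oplus>\<^bsub>M\<^esub> f w) ^^ N) z = ((\<lambda>w. y \<oplus>\<^bsub>M\<^esub> f w) ^^ N) z'"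
  shows "machine TYPE('x) K TK M T f"
proof -
  define \<Phi> where "\<Phi> y w = y \<oplus>\<^bsub>M\<^esub> f w" for y w
  have const': "(\<Phi> y ^^ N) z = (\<Phi> y ^^ N) z'"
    if "y \<in> carrier M" "z \<in> carrier M" "z' \<in> carrier M" for y z z'
    using const[OF that] by (simp add: \<Phi>_def[abs_def])
  have f_closed: "f z \<in> carrier M" if "z \<in> carrier M" for z
    using f that by (auto simp: continuous_map_def topspace_eq)
  have "\<exists>!h. h \<in> extensional (topspace X) \<and> continuous_map X T h \<and>
      (\<forall>x\<in>topspace X. h x = \<Phi> (g x) (h x))"
    if g: "continuous_map X T g" for X :: "'x topology" and g
  proof (rule ex1I)
    \<comment> \<open>Any starting point in the carrier would give the same values. Restricting to
      \<open>topspace X\<close> makes \<open>h\<close> extensional, as \<open>machine\<close>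
      demands.\<close>
    define h where "h = (\<lambda>x\<in>topspace X. (\<Phi> (g x) ^^ N) \<zero>\<^bsub>M\<^esub>)"
    have g_closed: "g x \<in> carrier M" if "x \<in> topspace X" for x
      using g that by (auto simp: continuous_map_def topspace_eq)
    have "continuous_map X T (\<lambda>x. (\<Phi> (g x) ^^ n) \<zero>\<^bsub>M\<^esub>)" for n
    proof (induction n)
      case 0
      then show ?case by (simp add: topspace_eq)
    next
      case (Suc n)
      from continuous_map_add[OF g continuous_map_compose[OF Suc f]]
      show ?case by (simp add: \<Phi>_def o_def)
    qed
    then have "continuous_map X T h"
      by (auto simp: h_def intro: continuous_map_eq)
    moreover have "h x = \<Phi> (g x) (h x)" if "x \<in> topspace X" for x
    proof -
      \<comment> \<open>The extra application of \<open>\<Phi> (g x)\<close> can be moved innermost,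
        where it only changes the starting point, and the \<open>N\<close>-th iterate ignores
        that.\<close>
      have "\<Phi> (g x) ((\<Phi> (g x) ^^ N) \<zero>\<^bsub>M\<^esub>) = (\<Phi> (g x) ^^ N) (\<Phi> (g x) \<zero>\<^bsub>M\<^esub>)"
        by (simp flip: funpow_swap1)
      also have "\<dots> = (\<Phi> (g x) ^^ N) \<zero>\<^bsub>M\<^esub>"
        using that g_closed f_closed by (intro const') (auto simp: \<Phi>_def)
      finally show ?thesis using that by (simp add: h_def)
    qed
    ultimately show "h \<in> extensional (topspace X) \<and> continuous_map X T h \<and>
        (\<forall>x\<in>topspace X. h x = \<Phi> (g x) (h x))"
      by (simp add: h_def)
    fix k
    assume k: "k \<in> extensional (topspace X) \<and> continuous_map X T k \<and>
        (\<forall>x\<in>topspace X. k x = \<Phi> (g x) (k x))"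
    show "k = h"
    proof (rule extensionalityI)
      fix x assume x: "x \<in> topspace X"
      then have "k x \<in> carrier M"
        using k by (auto simp: continuous_map_def topspace_eq)
      \<comment> \<open>A solution at \<open>x\<close> is fixed by every iterate, so it is the
        \<open>N\<close>-th iterate of itself and can be compared with the one started at
        zero.\<close>
      have "(\<Phi> (g x) ^^ n) (k x) = k x" for n
        using k x by (induction n) auto
      then have "k x = (\<Phi> (g x) ^^ N) (k x)" by simp
      also have "\<dots> = (\<Phi> (g x) ^^ N) \<zero>\<^bsub>M\<^esub>"
        using x g_closed \<open>k x \<in> carrier M\<close> by (intro const') auto
      finally show "k x = h x" using x by (simp add: h_def)
    qed (use k in \<open>auto simp: h_def\<close>)
  qed
  then show ?thesis
    using f topological_vector_space_axioms by (simp add: machine_def \<Phi>_def)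
qed

text \<open>The largest of the finitely many thresholds works for all of \<open>A\<close>.\<close>

lemma finite_eventually_sequentially_bound:
  fixes P :: "'a \<Rightarrow> nat \<Rightarrow> bool"
  assumes "finite A" "\<And>a. a \<in> A \<Longrightarrow> \<exists>n. \<forall>m\<ge>n. P a m"
  shows "\<exists>n. \<forall>m\<ge>n. \<forall>a\<in>A. P a m"
  using eventually_ball_finite[of A "\<lambda>m a. P a m" sequentially] assms
  by (auto simp: eventually_sequentially)

text \<open>Well-founded induction along \<open>R\<close>: once the components at all predecessors
  of \<open>v\<close> have forgotten the starting point, one further iteration makes the component
  at \<open>v\<close> forget it too. Finiteness of \<open>V\<close> turns the stages of the single
  vertices into a common \<open>N\<close>.\<close>

lemma machine_prod_module_wf:
  assumes tvs: "topological_vector_space K TK (prod_module V M) (product_topology T V)"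
    and "finite V" "wf R"
    and f: "continuous_map (product_topology T V) (product_topology T V) f"
    and local: "\<And>v z z'. \<lbrakk>v \<in> V; z \<in> carrier (prod_module V M); z' \<in> carrier (prod_module V M);
      \<And>u. \<lbrakk>u \<in> V; (u, v) \<in> R\<rbrakk> \<Longrightarrow> z u = z' u\<rbrakk> \<Longrightarrow> f z v = f z' v"
  shows "machine TYPE('x) K TK (prod_module V M) (product_topology T V) f"
proof -
  let ?P = "prod_module V M"
  interpret P: topological_vector_space K TK ?P "product_topology T V" by (fact tvs)
  define \<Phi> where "\<Phi> y w = y \<oplus>\<^bsub>?P\<^esub> f w" for y w
  have f_closed: "f z \<in> carrier ?P" if "z \<in> carrier ?P" for z
    using continuous_map_funspace[OF f] that unfolding P.topspace_eq by blast
  have iter_closed: "(\<Phi> y ^^ n) z \<in> carrier ?P" if "y \<in> carrier ?P" "z \<in> carrier ?P" for y z n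
    using that by (induction n) (auto simp: \<Phi>_def f_closed)
  \<comment> \<open>Quantifying over \<open>y\<close> inside \<open>settled\<close> makes the stage
    \<open>m\<close> uniform in \<open>y\<close>, as \<open>machineI_iterate\<close>
    requires.\<close>
  define settled where "settled v m \<longleftrightarrow>
    (\<forall>y\<in>carrier ?P. \<forall>z\<in>carrier ?P. \<forall>z'\<in>carrier ?P. (\<Phi> y ^^ m) z v = (\<Phi> y ^^ m) z' v)" for v m
  have settledD: "(\<Phi> y ^^ m) z v = (\<Phi> y ^^ m) z' v"
    if "settled v m" "y \<in> carrier ?P" "z \<in> carrier ?P" "z' \<in> carrier ?P" for v m y z z'
    using that unfolding settled_def by blast
  \<comment> \<open>The claim covers all later \<open>m\<close> because predecessors may settle at
    different stages, while the induction step needs one stage at which all of them are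
    settled.\<close>
  have ev: "\<exists>n. \<forall>m\<ge>n. settled v m" if "v \<in> V" for v
    using \<open>wf R\<close> that
  proof (induction v rule: wf_induct_rule)
    case (less v)
    have "\<exists>n. \<forall>m\<ge>n. \<forall>u\<in>{u\<in>V. (u, v) \<in> R}. settled u m"
      using \<open>finite V\<close> less.IH by (intro finite_eventually_sequentially_bound) simp_all
    then obtain n where n: "settled u m" if "m \<ge> n" "u \<in> V" "(u, v) \<in> R" for m u
      by blast
    have "settled v m" if "m \<ge> Suc n" for m
    proof -
      \<comment> \<open>As \<open>m\<close> is positive, one application of \<open>\<Phi> y\<close>
        can be peeled off, leaving a stage \<open>k\<close> at which all predecessors of
        \<open>v\<close> are already settled.\<close>
      obtain k where k: "m = Suc k" "k \<ge> n" using \<open>m \<ge> Suc n\<close> Suc_le_D by auto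
      have "(\<Phi> y ^^ m) z v = (\<Phi> y ^^ m) z' v"
        if "y \<in> carrier ?P" "z \<in> carrier ?P" "z' \<in> carrier ?P" for y z z'
      proof -
        have "f ((\<Phi> y ^^ k) z) v = f ((\<Phi> y ^^ k) z') v"
        proof (rule local[OF \<open>v \<in> V\<close>])
          show "(\<Phi> y ^^ k) z u = (\<Phi> y ^^ k) z' u" if "u \<in> V" "(u, v) \<in> R" for u
            using n[OF \<open>k \<ge> n\<close> that] \<open>y \<in> _\<close> \<open>z \<in> _\<close> \<open>z' \<in> _\<close> by (rule settledD)
        qed (intro iter_closed that)+
        then show ?thesis
          using k \<open>v \<in> V\<close> by (simp add: \<Phi>_def prod_module_simps)
      qed
      then show ?thesis unfolding settled_def by blast
    qed
    then show ?case by blast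
  qed
  obtain N where N: "settled v N" if "v \<in> V" for v
    using finite_eventually_sequentially_bound[of V settled, OF \<open>finite V\<close> ev] by blast
  have "(\<Phi> y ^^ N) z = (\<Phi> y ^^ N) z'"
    if "y \<in> carrier ?P" "z \<in> carrier ?P" "z' \<in> carrier ?P" for y z z'
  proof (rule PiE_ext)
    show "(\<Phi> y ^^ N) z \<in> (\<Pi>\<^sub>E v\<in>V. carrier (M v))" "(\<Phi> y ^^ N) z' \<in> (\<Pi>\<^sub>E v\<in>V. carrier (M v))"
      using iter_closed[of y z N] iter_closed[of y z' N] that by (simp_all add: prod_module_simps)
    show "(\<Phi> y ^^ N) z v = (\<Phi> y ^^ N) z' v" if "v \<in> V" for v
      using N[OF that] \<open>y \<in> _\<close> \<open>z \<in> _\<close> \<open>z' \<in> _\<close> by (rule settledD)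
  qed
  then show ?thesis
    unfolding \<Phi>_def[abs_def] by (rule P.machineI_iterate[OF f])
qed

section \<open>Acyclicity of the hypergraph as well-foundedness\<close>

text \<open>The underlying ordinary digraph. Sources come first in the pairs, so that well-founded
  induction passes from the sources of a hyperedge to its targets.\<close>

definition vertex_rel :: "'v hyperedge set \<Rightarrow> 'v rel" where
  "vertex_rel \<E> = {(u, v). \<exists>E\<in>\<E>. u \<in> src E \<and> v \<in> tgt E}"

text \<open>The new junction is \<open>hd vs\<close>, between \<open>E\<close> and
  \<open>hd es\<close>, at index 1; every later junction is an old one with its index shifted by
  one.\<close>

lemma hyperpath_Cons:
  assumes "hyperpath \<E> vs es" "E \<in> \<E>" "u \<in> src E" "hd vs \<in> tgt E"
  shows "hyperpath \<E> (u # vs) (E # es)"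
proof -
  have "vs \<noteq> []" "es \<noteq> []" using assms by (auto simp: hyperpath_def)
  have "(u # vs) ! j \<in> tgt ((E # es) ! (j - 1)) \<inter> src ((E # es) ! j)"
    if j: "j \<in> {1..<length (E # es)}" for j
  proof (cases "j = 1")
    case True
    then show ?thesis
      using assms \<open>vs \<noteq> []\<close> \<open>es \<noteq> []\<close> by (auto simp: hyperpath_def hd_conv_nth)
  next
    case False
    then obtain k where "j = Suc (Suc k)"
      using j by (cases j; cases "j - 1") auto
    moreover have "vs ! Suc k \<in> tgt (es ! (Suc k - 1)) \<inter> src (es ! Suc k)"
      using assms(1) j \<open>j = _\<close> by (force simp: hyperpath_def)
    ultimately show ?thesis by simp
  qed
  then show ?thesis
    using assms \<open>vs \<noteq> []\<close> \<open>es \<noteq> []\<close> by (simp add: hyperpath_def)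
qed

text \<open>Each pair in a chain is witnessed by a hyperedge. The induction grows the chain at its
  front, to match \<open>hyperpath_Cons\<close>.\<close>

lemma trancl_vertex_rel_hyperpath:
  assumes "(u, v) \<in> (vertex_rel \<E>)\<^sup>+"
  shows "\<exists>vs es. hyperpath \<E> vs es \<and> hd vs = u \<and> last vs = v"
  using assms
proof (induction rule: converse_trancl_induct)
  case (base u)
  then obtain E where "E \<in> \<E>" "u \<in> src E" "v \<in> tgt E" by (auto simp: vertex_rel_def)
  then have "hyperpath \<E> [u, v] [E]" by (simp add: hyperpath_def)
  then show ?case by force
next
  case (step u w)
  then obtain E vs es where E: "E \<in> \<E>" "u \<in> src E" "w \<in> tgt E"
    and vs: "hyperpath \<E> vs es" "hd vs = w" "last vs = v"
    by (auto simp: vertex_rel_def)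
  have "hyperpath \<E> (u # vs) (E # es)"
    using E vs by (intro hyperpath_Cons) auto
  moreover have "vs \<noteq> []" using vs by (auto simp: hyperpath_def)
  ultimately show ?case using vs by (metis last_ConsR list.sel(1))
qed

text \<open>A finite relation without cycles is well founded, and a cycle of
  \<open>vertex_rel\<close> would unfold to a hyperpath returning to its start.\<close>

lemma wf_vertex_rel:
  assumes "directed_hypergraph V \<E>" "acyclic_hypergraph \<E>"
  shows "wf (vertex_rel \<E>)"
proof (rule finite_acyclic_wf)
  have "vertex_rel \<E> \<subseteq> V \<times> V" "finite V"
    using assms(1) by (fastforce simp: directed_hypergraph_def vertex_rel_def)+
  then show "finite (vertex_rel \<E>)" by (blast intro: finite_subset)
  \<comment> \<open>The first vertex is a source of the first hyperedge, so returning to it is a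
    special case of closing up in the sense of \<open>hypercycle\<close>.\<close>
  have "hypercycle \<E> vs es" if "hyperpath \<E> vs es" "hd vs = last vs" for vs es
    using that by (auto simp: hypercycle_def hyperpath_def)
  then show "acyclic (vertex_rel \<E>)"
    using assms(2) unfolding acyclic_def acyclic_hypergraph_def
    by (metis trancl_vertex_rel_hyperpath)
qed

section \<open>The sum of the extended maps\<close>

text \<open>Evaluation at \<open>i\<close> is additive, so it passes through finite sums by
  induction. This reduces claims about a component of the total map to the single
  hyperedges.\<close>

lemma finsum_prod_module_apply:
  assumes "Module.module K (prod_module I M)" "i \<in> I" "Module.module K (M i)"
    and "finite A" "\<And>a. a \<in> A \<Longrightarrow> F a \<in> carrier (prod_module I M)"
  shows "(\<Oplus>\<^bsub>prod_module I M\<^esub>a\<in>A. F a) i = (\<Oplus>\<^bsub>M i\<^esub>a\<in>A. F a i)"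
proof -
  interpret P: Module.module K "prod_module I M" by fact
  interpret Mi: Module.module K "M i" by fact
  from \<open>finite A\<close> assms(5) show ?thesis
  proof (induction A rule: finite_induct)
    case empty
    then show ?case using \<open>i \<in> I\<close> by (simp add: prod_module_simps)
  next
    case (insert b A)
    have "(\<Oplus>\<^bsub>prod_module I M\<^esub>a\<in>insert b A. F a)
        = F b \<oplus>\<^bsub>prod_module I M\<^esub> (\<Oplus>\<^bsub>prod_module I M\<^esub>a\<in>A. F a)"
      using insert by (intro P.finsum_insert) auto
    moreover have "(\<Oplus>\<^bsub>M i\<^esub>a\<in>insert b A. F a i) = F b i \<oplus>\<^bsub>M i\<^esub> (\<Oplus>\<^bsub>M i\<^esub>a\<in>A. F a i)"
      using insert \<open>i \<in> I\<close> by (intro Mi.finsum_insert) (auto simp: prod_module_simps PiE_iff)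
    ultimately show ?case
      using insert \<open>i \<in> I\<close> by (simp add: prod_module_simps)
  qed
qed

text \<open>At a target of \<open>E\<close> the component is one of \<open>p E\<close> after
  restriction; elsewhere it is constantly zero, which is continuous because \<open>zero\<close>
  places that value in the space.\<close>

lemma continuous_map_extended_map:
  assumes "src E \<subseteq> V"
    and zero: "\<And>v. v \<in> V \<Longrightarrow> \<zero>\<^bsub>M v\<^esub> \<in> topspace (T v)"
    and p: "continuous_map (product_topology T (src E)) (product_topology T (tgt E)) (p E)"
  shows "continuous_map (product_topology T V) (product_topology T V) (extended_map V M p E)"
proof -
  have "continuous_map (product_topology T V) (product_topology T (src E)) (\<lambda>x. restrict x (src E))"
    using assms(1) by (auto simp: continuous_map_componentwise intro!: continuous_map_product_projection)
  from continuous_map_compose[OF this p]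
  have comp: "continuous_map (product_topology T V) (T v) (\<lambda>x. p E (restrict x (src E)) v)"
    if "v \<in> tgt E" for v
    using that by (auto simp: continuous_map_componentwise o_def)
  have "continuous_map (product_topology T V) (T v) (\<lambda>x. extended_map V M p E x v)" if "v \<in> V" for v
    using that zero comp by (cases "v \<in> tgt E") (auto simp: extended_map_def prod_incl_def prod_proj_def)
  then show ?thesis
    by (auto simp: continuous_map_componentwise extended_map_def prod_incl_def)
qed

theorem mainTheorem4:
  fixes K :: "'k ring" and TK :: "'k topology"
    and V :: "'v set" and \<E> :: "'v hyperedge set"
    and M :: "'v \<Rightarrow> ('k, 'm) module" and T :: "'v \<Rightarrow> 'm topology"
    and p :: "'v hyperedge \<Rightarrow> ('v \<Rightarrow> 'm) \<Rightarrow> ('v \<Rightarrow> 'm)"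
  assumes "topological_field K TK"
    and "directed_hypergraph V \<E>"
    and "acyclic_hypergraph \<E>"
    and "\<And>v. v \<in> V \<Longrightarrow> topological_vector_space K TK (M v) (T v)"
    and "\<And>E. E \<in> \<E> \<Longrightarrow>
      continuous_map (product_topology T (src E)) (product_topology T (tgt E)) (p E)"
  shows "machine TYPE('x) K TK (prod_module V M) (product_topology T V)
    (\<lambda>x. \<Oplus>\<^bsub>prod_module V M\<^esub>E\<in>\<E>. extended_map V M p E x)"
proof -
  let ?P = "prod_module V M" and ?f = "\<lambda>x. \<Oplus>\<^bsub>prod_module V M\<^esub>E\<in>\<E>. extended_map V M p E x"
  have tvs: "topological_vector_space K TK ?P (product_topology T V)"
    using assms(1,4) by (rule topological_vector_space_prod_module)
  then interpret P: topological_vector_space K TK ?P "product_topology T V" .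
  have mods: "Module.module K (M v)" if "v \<in> V" for v
    using assms(4)[OF that] by (simp add: topological_vector_space_def)
  have zero: "\<zero>\<^bsub>M v\<^esub> \<in> topspace (T v)" if "v \<in> V" for v
    using mods[OF that] assms(4)[OF that]
    by (simp add: topological_vector_space.topspace_eq Module.module_def abelian_group_def
        abelian_monoid.zero_closed)
  have sub: "src E \<subseteq> V" if "E \<in> \<E>" for E
    using assms(2) that by (force simp: directed_hypergraph_def)
  have fin: "finite V" "finite \<E>"
    using assms(2) by (auto simp: directed_hypergraph_def)
  have cont: "continuous_map (product_topology T V) (product_topology T V) (extended_map V M p E)"
    if "E \<in> \<E>" for E
    using that sub zero assms(5) by (intro continuous_map_extended_map) auto
  then have closed: "extended_map V M p E z \<in> carrier ?P" if "E \<in> \<E>" "z \<in> carrier ?P" for E z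
    using continuous_map_funspace[OF cont] that unfolding P.topspace_eq by blast
  show ?thesis
  proof (rule machine_prod_module_wf[OF tvs fin(1) wf_vertex_rel[OF assms(2,3)]])
    show "continuous_map (product_topology T V) (product_topology T V) ?f"
      using fin cont by (intro P.continuous_map_finsum)
    fix v z z'
    assume v: "v \<in> V" and z: "z \<in> carrier ?P" "z' \<in> carrier ?P"
      and eq: "\<And>u. \<lbrakk>u \<in> V; (u, v) \<in> vertex_rel \<E>\<rbrakk> \<Longrightarrow> z u = z' u"
    \<comment> \<open>If \<open>v\<close> is a target of \<open>E\<close>, all sources of
      \<open>E\<close> precede it in \<open>vertex_rel\<close>, so \<open>p E\<close> receives the
      same argument from \<open>z\<close> and \<open>z'\<close>; otherwise both components are
      zero.\<close>
    have "extended_map V M p E z v = extended_map V M p E z' v" if "E \<in> \<E>" for E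
    proof (cases "v \<in> tgt E")
      case True
      then have "restrict z (src E) = restrict z' (src E)"
        using sub[OF that] that by (intro restrict_ext eq) (auto simp: vertex_rel_def)
      then show ?thesis by (simp add: extended_map_def prod_proj_def)
    qed (simp add: extended_map_def prod_incl_def)
    \<comment> \<open>The congruence rule for finite sums asks for summands in the carrier.\<close>
    moreover have "extended_map V M p E z' v \<in> carrier (M v)" if "E \<in> \<E>" for E
      using closed[OF that z(2)] v by (auto simp: prod_module_simps)
    ultimately have "(\<Oplus>\<^bsub>M v\<^esub>E\<in>\<E>. extended_map V M p E z v) = (\<Oplus>\<^bsub>M v\<^esub>E\<in>\<E>. extended_map V M p E z' v)"
      using mods[OF v]
      by (intro abelian_monoid.finsum_cong'[OF _ refl]) (auto simp: Module.module_def abelian_group_def)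
    then show "?f z v = ?f z' v"
      using v z closed fin mods by (simp add: finsum_prod_module_apply[OF P.module_axioms])
  qed
qed

end
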